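(* $$\Pr(123\prec213)=e^{\frac32}\left(2-3\int_0^1e^{-t-\frac{t^2}{2}}\,dt\right)-1\approx0.412,$$ and this number equals $A(1)$, where $A(x)=\sum_{n\ge0}a_n\frac{x^n}{n!}$ and $a_n=|\mathrm{Av}_n^{123}(123,213)|$.
   Context: For a sequence of distinct reals, $\mathrm{st}$ replaces the smallest entry by $1$, the second smallest by $2$, etc. Let $X_1,X_2,\dots$ be i.i.d. continuous random variables (e.g. uniform on $[0,1]$). A consecutive occurrence of a permutation $\sigma$ of $\{1,\dots,k\}$ in a sequence or permutation is a block of $k$ adjacent entries whose standardization is $\sigma$. For distinct permutations $\sigma,\tau$ of the same length, $\Pr(\sigma\prec\tau)$ is the probability that the first consecutive occurrence of $\sigma$ in $X_1,X_2,\dots$ appears before the first consecutive occurrence of $\tau$. $\mathrm{Av}_n^{123}(123,213)$ is the set of permutations of $\{1,\dots,n\}$ whose last three entries form a consecutive occurrence of $123$ and which have no other consecutive occurrence of $123$ or $213$. *)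

theory Defs
  imports "HOL-Probability.Probability" "HOL-Combinatorics.Multiset_Permutations"
begin

text \<open>Permutations of \<open>{1..k}\<close> are written in one-line notation, as elements of
  \<^term>\<open>permutations_of_set {1..k::nat}\<close>.\<close>

definition st :: "'a::linorder list \<Rightarrow> nat list" where
  "st xs = map (\<lambda>x. card {y \<in> set xs. y \<le> x}) xs"

text \<open>Positions are counted from \<open>0\<close>. A block with a repeated entry standardizes to a list with a
  repeated entry, so it is never an occurrence of a permutation.\<close>

definition occurs_at :: "nat list \<Rightarrow> (nat \<Rightarrow> 'a::linorder) \<Rightarrow> nat \<Rightarrow> bool" where
  "occurs_at \<sigma> x i \<longleftrightarrow> st (map x [i..<i + length \<sigma>]) = \<sigma>"

definition list_occurs_at :: "nat list \<Rightarrow> 'a::linorder list \<Rightarrow> nat \<Rightarrow> bool" where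
  "list_occurs_at \<sigma> xs i \<longleftrightarrow>
     i + length \<sigma> \<le> length xs \<and> st (take (length \<sigma>) (drop i xs)) = \<sigma>"

text \<open>The value is \<^term>\<open>\<infinity>\<close> if \<open>\<sigma>\<close> never occurs.\<close>

definition first_occurrence :: "nat list \<Rightarrow> (nat \<Rightarrow> 'a::linorder) \<Rightarrow> enat" where
  "first_occurrence \<sigma> x = (INF i \<in> {i. occurs_at \<sigma> x i}. enat i)"

definition prob_precedes ::
    "'w measure \<Rightarrow> (nat \<Rightarrow> 'w \<Rightarrow> real) \<Rightarrow> nat list \<Rightarrow> nat list \<Rightarrow> real" where
  "prob_precedes M X \<sigma> \<tau> = measure M
     {\<omega> \<in> space M. first_occurrence \<sigma> (\<lambda>i. X i \<omega>) < first_occurrence \<tau> (\<lambda>i. X i \<omega>)}"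

text \<open>\<open>Av_ending n \<sigma> \<tau>\<close> is \<open>Av\<^sub>n\<^sup>\<sigma>(\<sigma>, \<tau>)\<close>, for distinct \<open>\<sigma>\<close> and \<open>\<tau>\<close> of the same length.\<close>

definition Av_ending :: "nat \<Rightarrow> nat list \<Rightarrow> nat list \<Rightarrow> nat list set" where
  "Av_ending n \<sigma> \<tau> = {\<pi> \<in> permutations_of_set {1..n}.
     \<exists>i. i + length \<sigma> = n \<and> list_occurs_at \<sigma> \<pi> i \<and>
         (\<forall>j. j \<noteq> i \<longrightarrow> \<not> list_occurs_at \<sigma> \<pi> j \<and> \<not> list_occurs_at \<tau> \<pi> j)}"

definition egf :: "(nat \<Rightarrow> nat) \<Rightarrow> real \<Rightarrow> real" where
  "egf a x = (\<Sum>n. real (a n) * (x ^ n / fact n))"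

end

theory Submission
  imports Defs
begin

text \<open>
  Let \<open>a\<^sub>n\<close> be the number of permutations in \<open>Av_ending n [1, 2, 3] [2, 1, 3]\<close>. The pattern 123
  precedes 213 exactly when, for some \<open>n\<close>, necessarily unique, the first \<open>n\<close> variables end with the
  first 123 and contain no 213. Since all \<open>n!\<close> relative orders of independent, identically
  distributed continuous variables are equally likely (\<open>prob_st_eq\<close>), this has probability
  \<open>a\<^sub>n / n!\<close>, and summing over \<open>n\<close> gives \<open>A(1)\<close> together with the convergence of the series
  (\<open>prob_precedes_sums\<close>, valid for any two distinct patterns of the same length).

  To determine \<open>a\<^sub>n\<close>, note that three adjacent distinct entries form 123 or 213 if and only if the third is
  the largest. Hence the maximum of a permutation that avoids both patterns is its first or second entry,
  and deleting it, together with its predecessor, leaves an arbitrary avoiding arrangement. For the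
  permutations counted by \<open>a\<^sub>n\<close> the maximum may also be the last entry, preceded by an avoiding
  arrangement that ends with an ascent. With \<open>c\<^sub>n\<close> counting the latter, and
  \<open>c\<^sub>0 = 1\<close> by convention, this yields, for \<open>n \<ge> 2\<close>,
  \<open>c\<^sub>n = c\<^sub>n\<^sub>-\<^sub>1 + (n - 1) c\<^sub>n\<^sub>-\<^sub>2\<close> and \<open>a\<^sub>n = a\<^sub>n\<^sub>-\<^sub>1 + (n - 1) a\<^sub>n\<^sub>-\<^sub>2 + c\<^sub>n\<^sub>-\<^sub>1\<close>
  (\<open>card_avoiding_up\<close>, \<open>card_first_123_at_end\<close>).

  The exponential generating functions therefore satisfy \<open>C' = (1 + x) C - 1\<close> and
  \<open>A' = (1 + x) A + C - 1\<close>. With \<open>J(x)\<close> the integral of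
  \<open>exp (- t - t\<^sup>2 / 2)\<close> from 0 to \<open>x\<close>, the solutions are \<open>C = exp (x + x\<^sup>2 / 2) (1 - J)\<close> and
  \<open>A = exp (x + x\<^sup>2 / 2) (x + 1 - (x + 2) J) - 1\<close> (\<open>eval_closed_form\<close>); \<open>x = 1\<close> is the formula
  claimed. The numerical value is read off from the rapidly convergent series rather than from the integral
  (\<open>eval_numeric\<close>).
\<close>

section \<open>Standardization and occurrences\<close>

text \<open>An entry of \<open>st xs\<close> is the rank of the corresponding entry of \<open>xs\<close>; ranking preserves strict
  order even when entries are repeated. All invariance properties of \<open>st\<close> rest on this.\<close>

lemma strict_mono_on_rank:
  fixes A :: "'a::linorder set"
  assumes "finite A"
  shows "strict_mono_on A (\<lambda>x. card {y \<in> A. y \<le> x})"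
proof (rule strict_mono_onI)
  fix x y assume xy: "x \<in> A" "y \<in> A" "x < y"
  have "{z \<in> A. z \<le> x} \<subset> {z \<in> A. z \<le> y}" using xy by force
  then show "card {z \<in> A. z \<le> x} < card {z \<in> A. z \<le> y}"
    using assms by (simp add: psubset_card_mono)
qed

lemma st_map_strict_mono:
  fixes f :: "'a::linorder \<Rightarrow> 'b::linorder"
  assumes "strict_mono_on (set xs) f"
  shows "st (map f xs) = st xs"
proof -
  have "card {y \<in> f ` set xs. y \<le> f x} = card {y \<in> set xs. y \<le> x}" if x: "x \<in> set xs" for x
  proof -
    have "{y \<in> f ` set xs. y \<le> f x} = f ` {y \<in> set xs. y \<le> x}"
      using x assms by (auto simp: strict_mono_on_less_eq)
    moreover have "inj_on f {y \<in> set xs. y \<le> x}"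
      using strict_mono_on_imp_inj_on[OF assms] by (rule inj_on_subset) auto
    ultimately show ?thesis by (simp add: card_image)
  qed
  then show ?thesis by (simp add: st_def)
qed

text \<open>The condition that defines \<open>Av_ending\<close>, freed from the requirement that the list is a
  permutation of \<open>{1..n}\<close>, so that it applies equally to a block of random values.\<close>

definition first_at_end :: "nat list \<Rightarrow> nat list \<Rightarrow> 'a::linorder list \<Rightarrow> bool" where
  "first_at_end \<sigma> \<tau> xs \<longleftrightarrow> (\<exists>i. i + length \<sigma> = length xs \<and> list_occurs_at \<sigma> xs i \<and>
     (\<forall>j. j \<noteq> i \<longrightarrow> \<not> list_occurs_at \<sigma> xs j \<and> \<not> list_occurs_at \<tau> xs j))"

lemma Av_ending_conv_first_at_end:
  "Av_ending n \<sigma> \<tau> = {\<pi> \<in> permutations_of_set {1..n}. first_at_end \<sigma> \<tau> \<pi>}"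
  unfolding Av_ending_def first_at_end_def
  by (rule Collect_cong) (auto simp: length_finite_permutations_of_set)

lemma length_st [simp]: "length (st xs) = length xs"
  by (simp add: st_def)

text \<open>Occurrences only depend on the relative order of the entries, and \<open>st\<close> keeps that order.\<close>

lemma list_occurs_at_st: "list_occurs_at \<sigma> (st xs) i \<longleftrightarrow> list_occurs_at \<sigma> xs i"
proof -
  let ?f = "\<lambda>x. card {y \<in> set xs. y \<le> x}"
  have "strict_mono_on (set (take (length \<sigma>) (drop i xs))) ?f"
    by (rule monotone_on_subset[OF strict_mono_on_rank])
       (auto dest: in_set_takeD in_set_dropD)
  from st_map_strict_mono[OF this] show ?thesis
    unfolding list_occurs_at_def st_def[of xs] by (simp add: take_map drop_map)
qed

lemma first_at_end_st [simp]: "first_at_end \<sigma> \<tau> (st xs) \<longleftrightarrow> first_at_end \<sigma> \<tau> xs"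
  by (simp add: first_at_end_def list_occurs_at_st)

lemma st_in_permutations_of_set:
  assumes "distinct xs"
  shows "st xs \<in> permutations_of_set {1..length xs}"
proof -
  let ?f = "\<lambda>x. card {y \<in> set xs. y \<le> x}"
  have inj: "inj_on ?f (set xs)"
    by (rule strict_mono_on_imp_inj_on[OF strict_mono_on_rank]) simp
  have "?f ` set xs \<subseteq> {1..length xs}"
  proof (clarsimp, intro conjI)
    fix x assume "x \<in> set xs"
    then have "{y \<in> set xs. y \<le> x} \<noteq> {}" by auto
    then show "Suc 0 \<le> ?f x"
      unfolding Suc_le_eq card_gt_0_iff by simp
    have "?f x \<le> card (set xs)" by (rule card_mono) auto
    then show "?f x \<le> length xs" using card_length[of xs] by linarith
  qed
  moreover have "card (?f ` set xs) = card {1..length xs}"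
    using inj assms by (simp add: card_image distinct_card)
  ultimately have "?f ` set xs = {1..length xs}"
    by (intro card_subset_eq) auto
  then show ?thesis
    using inj assms by (auto simp: st_def permutations_of_set_def distinct_map)
qed

section \<open>Lists avoiding 123 and 213\<close>

text \<open>For distinct entries, a block \<open>x, y, z\<close> is an occurrence of 123 or 213 exactly when
  \<open>z > max x y\<close>; so avoiding both patterns means that every entry from the third on is smaller than
  the larger of its two predecessors. \<open>avoiding_up\<close> requires this and a final ascent, which is
  what must precede a maximal last entry that completes a 123. The value \<open>True\<close> on the empty
  list makes the recurrence of \<open>num_up\<close> hold from the start: \<open>x # m # r\<close> with \<open>x < m\<close> qualifies
  for \<open>r = []\<close> as well.\<close>

fun avoiding_up :: "'a::linorder list \<Rightarrow> bool" where
  "avoiding_up [] \<longleftrightarrow> True"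
| "avoiding_up [x] \<longleftrightarrow> False"
| "avoiding_up [x, y] \<longleftrightarrow> x < y"
| "avoiding_up (x # y # z # zs) \<longleftrightarrow> z < max x y \<and> avoiding_up (y # z # zs)"

fun first_123_at_end :: "'a::linorder list \<Rightarrow> bool" where
  "first_123_at_end (x # y # z # zs) \<longleftrightarrow>
     (if zs = [] then x < y \<and> y < z else z < max x y \<and> first_123_at_end (y # z # zs))"
| "first_123_at_end _ \<longleftrightarrow> False"

lemma list_occurs_at_Cons_Suc [simp]:
  "list_occurs_at \<sigma> (x # xs) (Suc i) \<longleftrightarrow> list_occurs_at \<sigma> xs i"
  by (simp add: list_occurs_at_def)

lemma st_three:
  fixes x y z :: "'a::linorder"
  assumes "distinct [x, y, z]"
  shows "st [x, y, z] = [1 + of_bool (y < x) + of_bool (z < x),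
    1 + of_bool (x < y) + of_bool (z < y), 1 + of_bool (x < z) + of_bool (y < z)]"
proof -
  have *: "card {w. (w = u \<or> w = v \<or> w = v') \<and> w \<le> u} = 1 + of_bool (v < u) + of_bool (v' < u)"
    if "distinct [u, v, v']" for u v v' :: 'a
  proof -
    have "{w. (w = u \<or> w = v \<or> w = v') \<and> w \<le> u} =
        insert u ((if v < u then {v} else {}) \<union> (if v' < u then {v'} else {}))"
      using that by auto
    then show ?thesis using that by auto
  qed
  have "card {w. (w = x \<or> w = y \<or> w = z) \<and> w \<le> x} = 1 + of_bool (y < x) + of_bool (z < x)"
    using assms by (intro *) auto
  moreover have "card {w. (w = x \<or> w = y \<or> w = z) \<and> w \<le> y} = 1 + of_bool (x < y) + of_bool (z < y)"
    using assms *[of y x z] by (simp only: disj_left_commute) auto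
  moreover have "card {w. (w = x \<or> w = y \<or> w = z) \<and> w \<le> z} = 1 + of_bool (x < z) + of_bool (y < z)"
    using assms *[of z x y] by (simp only: disj_commute disj_left_commute) auto
  ultimately show ?thesis by (simp only: st_def list.map list.set insert_iff empty_iff simp_thms)
qed

lemma st_eq_123_iff:
  fixes x y z :: "'a::linorder"
  assumes "distinct [x, y, z]"
  shows "st [x, y, z] = [1, 2, 3] \<longleftrightarrow> x < y \<and> y < z"
    and "st [x, y, z] = [2, 1, 3] \<longleftrightarrow> y < x \<and> x < z"
  unfolding st_three[OF assms] using assms by (auto simp: of_bool_def split: if_splits)

text \<open>An occurrence at position \<open>Suc i\<close> of \<open>x # xs\<close> is one at position \<open>i\<close> of \<open>xs\<close>, so the
  positional description unfolds along the recursion of \<open>first_123_at_end\<close>.\<close>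

lemma first_123_at_end_iff:
  assumes "distinct xs"
  shows "first_123_at_end xs \<longleftrightarrow> first_at_end [1, 2, 3] [2, 1, 3] xs"
  unfolding first_at_end_def using assms
proof (induction xs rule: first_123_at_end.induct)
  case (1 x y z zs)
  have occ0: "list_occurs_at [1, 2, 3] (x # y # z # zs) 0 \<longleftrightarrow> x < y \<and> y < z"
             "list_occurs_at [2, 1, 3] (x # y # z # zs) 0 \<longleftrightarrow> y < x \<and> x < z"
    using st_eq_123_iff[of x y z] "1.prems" by (simp_all add: list_occurs_at_def)
  show ?case
  proof (cases "zs = []")
    case True
    have "\<not> list_occurs_at [1, 2, 3] [x, y, z] j \<and> \<not> list_occurs_at [2, 1, 3] [x, y, z] j"
      if "j \<noteq> 0" for j using that by (simp add: list_occurs_at_def)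
    then show ?thesis using occ0 True by auto
  next
    case False
    have neq: "x \<noteq> y" "x \<noteq> z" "y \<noteq> z" using "1.prems" by auto
    have "z < max x y \<longleftrightarrow> \<not> list_occurs_at [1, 2, 3] (x # y # z # zs) 0 \<and>
        \<not> list_occurs_at [2, 1, 3] (x # y # z # zs) 0"
      unfolding occ0 using neq by (auto simp: less_max_iff_disj)
    moreover have "(\<exists>i. i + 3 = length (x # y # z # zs) \<and> list_occurs_at [1, 2, 3] (x # y # z # zs) i \<and>
        (\<forall>j. j \<noteq> i \<longrightarrow> \<not> list_occurs_at [1, 2, 3] (x # y # z # zs) j
                    \<and> \<not> list_occurs_at [2, 1, 3] (x # y # z # zs) j)) \<longleftrightarrow>
      (\<not> list_occurs_at [1, 2, 3] (x # y # z # zs) 0 \<and>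
        \<not> list_occurs_at [2, 1, 3] (x # y # z # zs) 0) \<and>
      (\<exists>i. i + 3 = length (y # z # zs) \<and> list_occurs_at [1, 2, 3] (y # z # zs) i \<and>
        (\<forall>j. j \<noteq> i \<longrightarrow> \<not> list_occurs_at [1, 2, 3] (y # z # zs) j
                    \<and> \<not> list_occurs_at [2, 1, 3] (y # z # zs) j))" (is "(\<exists>i. ?P i) \<longleftrightarrow> ?Z \<and> (\<exists>i. ?R i)")
    proof -
      have "\<not> ?P 0" using False by simp
      moreover have "?P (Suc i) \<longleftrightarrow> ?Z \<and> ?R i" for i
      proof -
        have all: "(\<forall>j. j \<noteq> Suc i \<longrightarrow> Q j) \<longleftrightarrow> Q 0 \<and> (\<forall>j. j \<noteq> i \<longrightarrow> Q (Suc j))" for Q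
          by (metis nat.inject not0_implies_Suc old.nat.distinct(1))
        show ?thesis by (subst all) auto
      qed
      moreover have "(\<exists>i. ?P i) \<longleftrightarrow> ?P 0 \<or> (\<exists>i. ?P (Suc i))"
      proof (intro iffI, elim exE)
        fix i assume "?P i" then show "?P 0 \<or> (\<exists>i. ?P (Suc i))" by (cases i) blast+
      qed blast
      ultimately show ?thesis by (simp only: simp_thms ex_simps)
    qed
    ultimately show ?thesis using "1.IH" "1.prems" False by simp
  qed
qed (auto simp: list_occurs_at_def)

lemma Av_ending_123_213:
  "Av_ending n [1, 2, 3] [2, 1, 3] = {xs \<in> permutations_of_set {1..n}. first_123_at_end xs}"
  unfolding Av_ending_conv_first_at_end
  by (rule Collect_cong) (auto simp: first_123_at_end_iff permutations_of_setD)

section \<open>Counting by the position of the maximum\<close>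

lemma Cons_in_permutations_of_set_iff:
  "x # xs \<in> permutations_of_set S \<longleftrightarrow> x \<in> S \<and> xs \<in> permutations_of_set (S - {x})"
  unfolding permutations_of_set_def by auto

text \<open>The arrangements of \<open>S\<close> are split according to whether a chosen element \<open>m\<close> comes first,
  second, or later. Arrangements of arbitrary finite sets, rather than of \<open>{1..n}\<close>, are counted so
  that what remains after deleting entries is again an arrangement of a set and no renumbering is
  needed.\<close>

lemma card_permutations_by_max:
  fixes S :: "'a::linorder set"
  assumes S: "finite S" "2 \<le> card S" and m: "m \<in> S"
  shows "card {xs \<in> permutations_of_set S. P xs} =
     card {r \<in> permutations_of_set (S - {m}). P (m # r)} +
     (\<Sum>x\<in>S - {m}. card {r \<in> permutations_of_set (S - {x, m}). P (x # m # r)}) +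
     card {us @ m # vs |us vs. us @ m # vs \<in> permutations_of_set S \<and> 2 \<le> length us \<and> P (us @ m # vs)}"
    (is "card ?A = card ?A1 + (\<Sum>x\<in>_. card (?A2 x)) + card ?A3")
proof -
  let ?B2 = "\<Union>x\<in>S - {m}. (\<lambda>r. x # m # r) ` ?A2 x"
  have fin: "finite ?A" by simp
  have A: "?A = (#) m ` ?A1 \<union> ?B2 \<union> ?A3"
  proof (intro equalityI subsetI)
    fix xs assume xs: "xs \<in> ?A"
    then have "m \<in> set xs" using m by (auto dest: permutations_of_setD)
    then obtain us vs where uv: "xs = us @ m # vs" by (auto dest: split_list)
    have ds: "distinct xs" "set xs = S" using xs by (auto dest: permutations_of_setD)
    consider "us = []" | x where "us = [x]" | "2 \<le> length us"
      by (cases us rule: list.exhaust; cases "tl us") auto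
    then show "xs \<in> (#) m ` ?A1 \<union> ?B2 \<union> ?A3"
    proof cases
      case 1
      then have "vs \<in> ?A1" using uv ds xs by (auto simp: permutations_of_set_def)
      then show ?thesis using 1 uv by simp
    next
      case (2 x)
      then have "vs \<in> ?A2 x" "x \<in> S - {m}" using uv ds xs by (auto simp: permutations_of_set_def)
      then show ?thesis using 2 uv by auto
    next
      case 3
      then show ?thesis using uv xs by blast
    qed
  next
    fix xs assume "xs \<in> (#) m ` ?A1 \<union> ?B2 \<union> ?A3"
    then consider r where "r \<in> ?A1" "xs = m # r"
      | x r where "x \<in> S - {m}" "r \<in> ?A2 x" "xs = x # m # r"
      | "xs \<in> ?A3" by blast
    then show "xs \<in> ?A"
      by cases (use m in \<open>auto simp: Cons_in_permutations_of_set_iff Diff_insert[symmetric] insert_commute\<close>)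
  qed
  have disj1: "(#) m ` ?A1 \<inter> ?B2 = {}" by auto
  have disj2: "((#) m ` ?A1 \<union> ?B2) \<inter> ?A3 = {}"
  proof -
    have False if xs: "xs \<in> ?A3" "xs = m # r \<or> xs = x # m # r" for xs r x
    proof -
      obtain us vs where uv: "xs = us @ m # vs" "us @ m # vs \<in> permutations_of_set S" "2 \<le> length us"
        using xs(1) by blast
      have "distinct xs" unfolding uv(1) using uv(2) by (rule permutations_of_setD(2))
      obtain y z us' where "us = y # z # us'" using uv(3)
        by (cases us rule: list.exhaust; cases "tl us") auto
      then show False using uv \<open>distinct xs\<close> xs(2) by auto
    qed
    then show ?thesis by blast
  qed
  have "card ?A = card ((#) m ` ?A1) + card ?B2 + card ?A3"
  proof -
    have "finite ((#) m ` ?A1 \<union> ?B2)" "finite ?A3" "finite ((#) m ` ?A1)" "finite ?B2"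
      using fin unfolding A by (simp_all only: finite_Un)
    then show ?thesis
      by (simp only: A card_Un_disjoint[OF _ _ disj2] card_Un_disjoint[OF _ _ disj1])
  qed
  also have "card ((#) m ` ?A1) = card ?A1" by (simp add: card_image)
  also have "card ?B2 = (\<Sum>x\<in>S - {m}. card ((\<lambda>r. x # m # r) ` ?A2 x))"
    using S by (intro card_UN_disjoint) auto
  also have "\<dots> = (\<Sum>x\<in>S - {m}. card (?A2 x))"
    by (intro sum.cong refl card_image) (auto simp: inj_on_def)
  finally show ?thesis .
qed

text \<open>A maximal entry in one of the first two places dominates every comparison in which it takes
  part, so it can be deleted together with its predecessor. From the third place on it is larger
  than both of its predecessors, hence completes a 123 or a 213, which must then be the final
  block. The following six lemmas express this for the two predicates.\<close>

lemma avoiding_up_max_first: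
  assumes "\<forall>y\<in>set r. y < m" "r \<noteq> []"
  shows "avoiding_up (m # r) \<longleftrightarrow> avoiding_up r"
  using assms by (cases r rule: avoiding_up.cases) (auto simp: max_def)

lemma avoiding_up_max_second:
  assumes "\<forall>y\<in>set r. y < m" "x < m"
  shows "avoiding_up (x # m # r) \<longleftrightarrow> avoiding_up r"
  using assms by (cases r rule: avoiding_up.cases) (auto simp: max_def)

lemma avoiding_up_max_later:
  assumes "\<forall>y\<in>set us. y < m" "2 \<le> length us"
  shows "\<not> avoiding_up (us @ m # vs)"
  using assms
proof (induction us rule: avoiding_up.induct)
  case (3 x y)
  then show ?case by (auto simp: less_max_iff_disj)
next
  case (4 x y z zs)
  then show ?case by auto
qed auto

lemma first_123_max_first:
  assumes "\<forall>y\<in>set r. y < m"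
  shows "first_123_at_end (m # r) \<longleftrightarrow> first_123_at_end r"
  using assms by (cases r rule: first_123_at_end.cases) (auto simp: max_def)

lemma first_123_max_second:
  assumes "\<forall>y\<in>set r. y < m" "x < m"
  shows "first_123_at_end (x # m # r) \<longleftrightarrow> first_123_at_end r"
  using assms by (cases r rule: first_123_at_end.cases) (auto simp: max_def)

lemma first_123_max_later:
  assumes "\<forall>y\<in>set us. y < m" "2 \<le> length us"
  shows "first_123_at_end (us @ m # vs) \<longleftrightarrow> vs = [] \<and> avoiding_up us"
  using assms
proof (induction us rule: avoiding_up.induct)
  case (3 x y)
  then show ?case by (auto simp: less_max_iff_disj)
next
  case (4 x y z zs)
  then show ?case by auto
qed auto

text \<open>The two recurrences produced by the position of the maximum; \<open>num_up\<close> also enters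
  \<open>num_first_123\<close> because a maximum in the last place completes the first 123 after any list
  counted by \<open>num_up\<close>.\<close>

fun num_up :: "nat \<Rightarrow> nat" where
  "num_up 0 = 1"
| "num_up (Suc 0) = 0"
| "num_up (Suc (Suc n)) = num_up (Suc n) + Suc n * num_up n"

fun num_first_123 :: "nat \<Rightarrow> nat" where
  "num_first_123 0 = 0"
| "num_first_123 (Suc 0) = 0"
| "num_first_123 (Suc (Suc n)) = num_first_123 (Suc n) + Suc n * num_first_123 n + num_up (Suc n)"

lemma card_avoiding_up:
  fixes S :: "'a::linorder set"
  assumes "finite S"
  shows "card {xs \<in> permutations_of_set S. avoiding_up xs} = num_up (card S)"
  using assms
proof (induction "card S" arbitrary: S rule: num_up.induct)
  case 1
  then have "S = {}" by simp
  moreover have "{xs :: 'a list. xs = [] \<and> avoiding_up xs} = {[]}" by auto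
  ultimately show ?case by simp
next
  case 2
  then obtain x where "S = {x}" by (metis card_1_singletonE One_nat_def)
  moreover have "{xs. xs = [x] \<and> avoiding_up xs} = {}" by auto
  ultimately show ?case by simp
next
  case (3 n)
  define m where "m = Max S"
  have ne: "S \<noteq> {}" using 3 by auto
  have lt: "y < m" if "y \<in> S - {m}" for y
    using that 3 ne unfolding m_def by (auto simp: less_le)
  have m: "m \<in> S" using ne 3 unfolding m_def by simp
  have "{r \<in> permutations_of_set (S - {m}). avoiding_up (m # r)} =
        {r \<in> permutations_of_set (S - {m}). avoiding_up r}"
  proof (rule Collect_cong, rule conj_cong[OF refl])
    fix r assume r: "r \<in> permutations_of_set (S - {m})"
    have "card (S - {m}) = Suc n" using 3 m by simp
    then have "r \<noteq> []" using permutations_of_setD(1)[OF r] by (metis card.empty list.set(1) nat.simps(3))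
    then show "avoiding_up (m # r) = avoiding_up r"
      using r lt by (intro avoiding_up_max_first) (auto dest: permutations_of_setD)
  qed
  moreover have "{r \<in> permutations_of_set (S - {x, m}). avoiding_up (x # m # r)} =
        {r \<in> permutations_of_set (S - {x, m}). avoiding_up r}" if "x \<in> S - {m}" for x
    using that lt by (intro Collect_cong conj_cong refl avoiding_up_max_second)
      (auto dest: permutations_of_setD)
  moreover have "card {us @ m # vs |us vs. us @ m # vs \<in> permutations_of_set S \<and> 2 \<le> length us
      \<and> avoiding_up (us @ m # vs)} = 0"
  proof -
    have "\<not> avoiding_up (us @ m # vs)" if "us @ m # vs \<in> permutations_of_set S" "2 \<le> length us" for us vs
      using that permutations_of_setD[OF that(1)] lt by (intro avoiding_up_max_later) auto
    then have "{us @ m # vs |us vs. us @ m # vs \<in> permutations_of_set S \<and> 2 \<le> length us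
      \<and> avoiding_up (us @ m # vs)} = {}" by blast
    then show ?thesis by (simp only: card.empty)
  qed
  moreover have "card {r \<in> permutations_of_set (S - {m}). avoiding_up r} = num_up (Suc n)"
    using 3 m by (metis card_Diff_singleton diff_Suc_1 finite_Diff)
  moreover have "card {r \<in> permutations_of_set (S - {x, m}). avoiding_up r} = num_up n"
    if "x \<in> S - {m}" for x
  proof -
    have "n = card (S - {x, m})" using that 3 m by (simp add: card_Diff_subset)
    then show ?thesis using "3.hyps"(2) "3.prems" by auto
  qed
  moreover have "card (S - {m}) = Suc n" using 3 m by simp
  ultimately show ?case
    using card_permutations_by_max[of S m avoiding_up] "3.prems" "3.hyps"(3)[symmetric] m by simp
qed

lemma card_first_123_at_end:
  fixes S :: "'a::linorder set"
  assumes "finite S"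
  shows "card {xs \<in> permutations_of_set S. first_123_at_end xs} = num_first_123 (card S)"
  using assms
proof (induction "card S" arbitrary: S rule: num_first_123.induct)
  case 1
  then have "S = {}" by simp
  moreover have "{xs :: 'a list. xs = [] \<and> first_123_at_end xs} = {}" by auto
  ultimately show ?case by simp
next
  case 2
  then obtain x where "S = {x}" by (metis card_1_singletonE One_nat_def)
  moreover have "{xs. xs = [x] \<and> first_123_at_end xs} = {}" by auto
  ultimately show ?case by simp
next
  case (3 n)
  define m where "m = Max S"
  have ne: "S \<noteq> {}" using 3 by auto
  have lt: "y < m" if "y \<in> S - {m}" for y
    using that 3 ne unfolding m_def by (auto simp: less_le)
  have m: "m \<in> S" using ne 3 unfolding m_def by simp
  have cm: "card (S - {m}) = Suc n" using 3 m by simp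
  have "{r \<in> permutations_of_set (S - {m}). first_123_at_end (m # r)} =
        {r \<in> permutations_of_set (S - {m}). first_123_at_end r}"
    using lt by (intro Collect_cong conj_cong refl first_123_max_first)
      (auto dest: permutations_of_setD)
  moreover have "{r \<in> permutations_of_set (S - {x, m}). first_123_at_end (x # m # r)} =
        {r \<in> permutations_of_set (S - {x, m}). first_123_at_end r}" if "x \<in> S - {m}" for x
    using that lt by (intro Collect_cong conj_cong refl first_123_max_second)
      (auto dest: permutations_of_setD)
  moreover have "card {us @ m # vs |us vs. us @ m # vs \<in> permutations_of_set S \<and> 2 \<le> length us
      \<and> first_123_at_end (us @ m # vs)} = num_up (Suc n)"
  proof -
    have *: "first_123_at_end (us @ m # vs) \<longleftrightarrow> vs = [] \<and> avoiding_up us"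
      if "us @ m # vs \<in> permutations_of_set S" "2 \<le> length us" for us vs
      using that permutations_of_setD[OF that(1)] lt by (intro first_123_max_later) auto
    have **: "2 \<le> length us" if "us \<in> permutations_of_set (S - {m})" "avoiding_up us" for us
    proof -
      have "us \<noteq> []" using permutations_of_setD(1)[OF that(1)] cm by (metis card.empty list.set(1) nat.simps(3))
      then show ?thesis using that by (cases us rule: avoiding_up.cases) auto
    qed
    have "{us @ m # vs |us vs. us @ m # vs \<in> permutations_of_set S \<and> 2 \<le> length us
        \<and> first_123_at_end (us @ m # vs)} =
        (\<lambda>us. us @ [m]) ` {us \<in> permutations_of_set (S - {m}). avoiding_up us}" (is "?L = ?R")
    proof (intro equalityI subsetI)
      fix xs assume "xs \<in> ?L"
      then obtain us where "xs = us @ [m]" "us @ [m] \<in> permutations_of_set S" "avoiding_up us"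
        using * by auto
      then show "xs \<in> ?R" by (auto simp: permutations_of_set_def)
    next
      fix xs assume "xs \<in> ?R"
      then obtain us where us: "xs = us @ [m]" "us \<in> permutations_of_set (S - {m})" "avoiding_up us"
        by auto
      moreover from us m have "us @ [m] \<in> permutations_of_set S"
        by (auto simp: permutations_of_set_def)
      ultimately show "xs \<in> ?L" using * ** by blast
    qed
    then have "card ?L = card {us \<in> permutations_of_set (S - {m}). avoiding_up us}"
      by (simp add: card_image inj_on_def)
    then show ?thesis using card_avoiding_up[of "S - {m}"] "3.prems" cm by simp
  qed
  moreover have "card {r \<in> permutations_of_set (S - {m}). first_123_at_end r} = num_first_123 (Suc n)"
    using "3.hyps"(1)[of "S - {m}"] "3.prems" cm by simp
  moreover have "card {r \<in> permutations_of_set (S - {x, m}). first_123_at_end r} = num_first_123 n"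
    if "x \<in> S - {m}" for x
  proof -
    have "n = card (S - {x, m})" using that 3 m by (simp add: card_Diff_subset)
    then show ?thesis using "3.hyps"(2) "3.prems" by auto
  qed
  ultimately show ?case
    using card_permutations_by_max[of S m first_123_at_end] "3.prems" "3.hyps"(3)[symmetric] m cm by simp
qed

section \<open>First occurrences in an infinite sequence\<close>

lemma first_occurrence_less_iff:
  "first_occurrence \<sigma> x < first_occurrence \<tau> x \<longleftrightarrow>
     (\<exists>i. occurs_at \<sigma> x i \<and> (\<forall>j. occurs_at \<tau> x j \<longrightarrow> i < j))"
proof -
  have "enat i < (INF j\<in>B. enat j) \<longleftrightarrow> (\<forall>j\<in>B. i < j)" for i B
  proof
    assume "\<forall>j\<in>B. i < j"
    then have "enat (Suc i) \<le> (INF j\<in>B. enat j)" by (intro INF_greatest) (simp add: Suc_leI)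
    then show "enat i < (INF j\<in>B. enat j)"
      using less_le_trans[of "enat i" "enat (Suc i)"] by simp
  next
    assume "enat i < (INF j\<in>B. enat j)"
    then show "\<forall>j\<in>B. i < j" by (auto dest!: less_INF_D)
  qed
  then show ?thesis unfolding first_occurrence_def by (simp add: INF_less_iff)
qed

lemma list_occurs_at_map_upt:
  "list_occurs_at \<sigma> (map x [0..<n]) i \<longleftrightarrow> i + length \<sigma> \<le> n \<and> occurs_at \<sigma> x i"
  by (auto simp: list_occurs_at_def occurs_at_def take_map drop_map)

text \<open>At most one of two distinct patterns of the same length occurs at a given position, which is
  why \<open>\<tau>\<close> is excluded at \<open>i\<close> itself and the last condition can be read as \<open>i < j\<close>.\<close>

lemma first_at_end_map_upt:
  assumes "length \<tau> = length \<sigma>" "\<sigma> \<noteq> \<tau>"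
  shows "first_at_end \<sigma> \<tau> (map x [0..<n]) \<longleftrightarrow>
    (\<exists>i. n = i + length \<sigma> \<and> occurs_at \<sigma> x i \<and> (\<forall>j<i. \<not> occurs_at \<sigma> x j) \<and>
       (\<forall>j. occurs_at \<tau> x j \<longrightarrow> i < j))"
proof -
  have "\<not> occurs_at \<tau> x i" if "occurs_at \<sigma> x i" for i
    using that assms by (auto simp: occurs_at_def)
  then have "(\<forall>j. j \<noteq> i \<longrightarrow> \<not> (j \<le> i \<and> occurs_at \<sigma> x j) \<and> \<not> (j \<le> i \<and> occurs_at \<tau> x j)) \<longleftrightarrow>
      (\<forall>j<i. \<not> occurs_at \<sigma> x j) \<and> (\<forall>j. occurs_at \<tau> x j \<longrightarrow> i < j)"
    if "occurs_at \<sigma> x i" for i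
    using that by (metis less_le linorder_not_less)
  then show ?thesis
    unfolding first_at_end_def list_occurs_at_map_upt using assms(1)
    by (auto, meson leD)
qed

lemma first_occurrence_less_iff_first_at_end:
  assumes "length \<tau> = length \<sigma>" "\<sigma> \<noteq> \<tau>"
  shows "first_occurrence \<sigma> x < first_occurrence \<tau> x \<longleftrightarrow>
     (\<exists>n. first_at_end \<sigma> \<tau> (map x [0..<n]))"
proof
  assume "first_occurrence \<sigma> x < first_occurrence \<tau> x"
  then obtain i where i: "occurs_at \<sigma> x i" "\<forall>j. occurs_at \<tau> x j \<longrightarrow> i < j"
    unfolding first_occurrence_less_iff by blast
  define l where "l = (LEAST i. occurs_at \<sigma> x i)"
  have "occurs_at \<sigma> x l" "l \<le> i" "\<forall>j<l. \<not> occurs_at \<sigma> x j"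
    unfolding l_def using i(1) by (auto intro: LeastI Least_le dest: not_less_Least)
  then have "first_at_end \<sigma> \<tau> (map x [0..<l + length \<sigma>])"
    unfolding first_at_end_map_upt[OF assms] using i(2) by (auto intro: le_less_trans)
  then show "\<exists>n. first_at_end \<sigma> \<tau> (map x [0..<n])" ..
next
  assume "\<exists>n. first_at_end \<sigma> \<tau> (map x [0..<n])"
  then show "first_occurrence \<sigma> x < first_occurrence \<tau> x"
    unfolding first_at_end_map_upt[OF assms] first_occurrence_less_iff by blast
qed

lemma first_at_end_unique:
  assumes "length \<tau> = length \<sigma>" "\<sigma> \<noteq> \<tau>"
  shows "\<exists>\<^sub>\<le>\<^sub>1n. first_at_end \<sigma> \<tau> (map x [0..<n])"
  unfolding first_at_end_map_upt[OF assms] Uniq_def by (metis linorder_neqE_nat)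

section \<open>Standardizations of random sequences\<close>

text \<open>The rank counts distinct values; counting the index at which each value appears first turns
  it into a count of indices that is determined by the comparisons between entries.\<close>

lemma st_map_upt:
  "st (map f [0..<n]) = map (\<lambda>i. card {j \<in> {..<n}. f j \<le> f i \<and> (\<forall>k<j. f k \<noteq> f j)}) [0..<n]"
proof -
  have "card {y \<in> f ` {0..<n}. y \<le> f i} = card {j \<in> {..<n}. f j \<le> f i \<and> (\<forall>k<j. f k \<noteq> f j)}"
    (is "card ?Y = card ?J") for i
  proof -
    have "f ` ?J = ?Y"
    proof (intro equalityI subsetI)
      fix y assume "y \<in> ?Y"
      then obtain j where j: "j < n" "y = f j" "y \<le> f i" by auto
      define l where "l = (LEAST k. f k = y)"
      have "f l = y" "l \<le> j" "\<forall>k<l. f k \<noteq> y"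
        unfolding l_def using j by (auto intro: LeastI Least_le dest: not_less_Least)
      then show "y \<in> f ` ?J" using j by (intro image_eqI[of _ _ l]) auto
    qed auto
    moreover have "inj_on f ?J" by (rule inj_onI) (auto, metis linorder_neqE_nat)
    ultimately show ?thesis using card_image[of f ?J] by (simp only:)
  qed
  then show ?thesis by (simp add: st_def)
qed

text \<open>The standardization is a function of the finite set \<open>R\<close> of index pairs with
  \<open>Y i \<omega> \<le> Y j \<omega>\<close>, and each value of \<open>R\<close> is attained on a measurable set.\<close>

lemma measurable_st:
  fixes Y :: "nat \<Rightarrow> 'w \<Rightarrow> real"
  assumes Y: "\<And>i. i < n \<Longrightarrow> Y i \<in> borel_measurable N"
  shows "(\<lambda>\<omega>. st (map (\<lambda>i. Y i \<omega>) [0..<n])) \<in> measurable N (count_space UNIV)"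
proof -
  define R where "R = (\<lambda>\<omega>. {(i, j). i < n \<and> j < n \<and> Y i \<omega> \<le> Y j \<omega>})"
  define G where "G = (\<lambda>r. map (\<lambda>i. card {j \<in> {..<n}. (j, i) \<in> r \<and>
      (\<forall>k<j. \<not> ((k, j) \<in> r \<and> (j, k) \<in> r))}) [0..<n])"
  have "R \<in> measurable N (count_space (Pow ({..<n} \<times> {..<n})))"
  proof (subst measurable_count_space_eq2, safe)
    fix r :: "(nat \<times> nat) set" assume r: "r \<subseteq> {..<n} \<times> {..<n}"
    have "R -` {r} \<inter> space N =
        {\<omega> \<in> space N. \<forall>i\<in>{..<n}. \<forall>j\<in>{..<n}. Y i \<omega> \<le> Y j \<omega> \<longleftrightarrow> (i, j) \<in> r}"
      using r by (auto simp: R_def set_eq_iff)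
    also have "\<dots> \<in> sets N" using Y by measurable
    finally show "R -` {r} \<inter> space N \<in> sets N" .
  qed (auto simp: R_def)
  moreover have "G \<in> measurable (count_space (Pow ({..<n} \<times> {..<n}))) (count_space UNIV)"
    by simp
  ultimately have "(\<lambda>\<omega>. G (R \<omega>)) \<in> measurable N (count_space UNIV)"
    by (rule measurable_compose)
  moreover have "G (R \<omega>) = st (map (\<lambda>i. Y i \<omega>) [0..<n])" for \<omega>
  proof -
    have "{j \<in> {..<n}. (j, i) \<in> R \<omega> \<and> (\<forall>k<j. \<not> ((k, j) \<in> R \<omega> \<and> (j, k) \<in> R \<omega>))} =
        {j \<in> {..<n}. Y j \<omega> \<le> Y i \<omega> \<and> (\<forall>k<j. Y k \<omega> \<noteq> Y j \<omega>)}" if "i < n" for i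
    proof (intro Collect_cong conj_cong refl all_cong)
      fix j assume "j \<in> {..<n}"
      then show "(j, i) \<in> R \<omega> \<longleftrightarrow> Y j \<omega> \<le> Y i \<omega>" using that by (simp add: R_def)
    next
      fix j k assume "j \<in> {..<n}" "k < j"
      then show "\<not> ((k, j) \<in> R \<omega> \<and> (j, k) \<in> R \<omega>) \<longleftrightarrow> Y k \<omega> \<noteq> Y j \<omega>"
        by (auto simp: R_def)
    qed
    then show ?thesis
      unfolding st_map_upt G_def
      by (intro map_cong refl arg_cong[where f = card]) (simp only: set_upt atLeastLessThan_iff)
  qed
  ultimately show ?thesis by simp
qed

locale iid_continuous = prob_space M for M :: "'w measure" +
  fixes X :: "nat \<Rightarrow> 'w \<Rightarrow> real"
  assumes indep: "indep_vars (\<lambda>_. borel) X UNIV"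
    and ident: "\<And>i j. distr M borel (X i) = distr M borel (X j)"
    and cont: "\<And>i. continuous_on UNIV (cdf (distr M borel (X i)))"
begin

lemma X_measurable [measurable]: "X i \<in> borel_measurable M"
  using indep by (simp add: indep_vars_def)

text \<open>The joint law of two of the variables is a product measure, whose mass on the diagonal is the
  integral of the masses of single points; these vanish because the distribution function is
  continuous.\<close>

lemma AE_distinct: "AE \<omega> in M. distinct (map (\<lambda>i. X i \<omega>) [0..<n])"
proof -
  have "AE \<omega> in M. X i \<omega> \<noteq> X j \<omega>" if ij: "i \<noteq> j" for i j
  proof -
    have "indep_var (Pi\<^sub>M {i} (\<lambda>_. borel)) (\<lambda>\<omega>. restrict (\<lambda>k. X k \<omega>) {i})
                    (Pi\<^sub>M {j} (\<lambda>_. borel)) (\<lambda>\<omega>. restrict (\<lambda>k. X k \<omega>) {j})"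
      using ij by (intro indep_var_restrict[OF indep]) auto
    then have "indep_var borel ((\<lambda>f. f i) \<circ> (\<lambda>\<omega>. restrict (\<lambda>k. X k \<omega>) {i}))
                         borel ((\<lambda>f. f j) \<circ> (\<lambda>\<omega>. restrict (\<lambda>k. X k \<omega>) {j}))"
      by (rule indep_var_compose) auto
    then have "indep_var borel (X i) borel (X j)" by (simp add: o_def)
    then have joint: "distr M (borel \<Otimes>\<^sub>M borel) (\<lambda>\<omega>. (X i \<omega>, X j \<omega>)) =
        distr M borel (X i) \<Otimes>\<^sub>M distr M borel (X j)"
      by (simp add: indep_var_distribution_eq)
    interpret D: real_distribution "distr M borel (X j)"
      by (rule real_distribution_distr) simp
    have point: "emeasure (distr M borel (X j)) {x} = 0" for x
      using cont[of j] D.isCont_cdf[of x] by (simp add: continuous_on_eq_continuous_at D.emeasure_eq_measure)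
    let ?D = "{z :: real \<times> real. fst z = snd z}"
    have D: "?D \<in> sets (borel \<Otimes>\<^sub>M borel)"
    proof -
      have "{z \<in> space (borel \<Otimes>\<^sub>M borel :: (real \<times> real) measure). fst z = snd z} \<in> sets (borel \<Otimes>\<^sub>M borel)"
        by measurable
      then show ?thesis by (simp add: space_pair_measure)
    qed
    have vim: "Pair x -` ?D = {x}" for x :: real by auto
    have "emeasure M {\<omega> \<in> space M. X i \<omega> = X j \<omega>} =
        emeasure (distr M (borel \<Otimes>\<^sub>M borel) (\<lambda>\<omega>. (X i \<omega>, X j \<omega>))) ?D"
      using D by (subst emeasure_distr) (auto intro!: arg_cong[where f = "emeasure M"])
    also have "\<dots> = (\<integral>\<^sup>+x. emeasure (distr M borel (X j)) (Pair x -` ?D) \<partial>distr M borel (X i))"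
      unfolding joint using D
      by (intro D.emeasure_pair_measure_alt) (simp cong: sets_pair_measure_cong)
    also have "\<dots> = 0" unfolding vim by (simp add: point)
    finally show ?thesis by (intro AE_I[where N = "{\<omega> \<in> space M. X i \<omega> = X j \<omega>}"]) auto
  qed
  then have "AE \<omega> in M. \<forall>i j. i \<noteq> j \<longrightarrow> X i \<omega> \<noteq> X j \<omega>" by (simp add: AE_all_countable)
  then show ?thesis by eventually_elim (auto simp: distinct_map inj_on_def)
qed

text \<open>Selecting distinct coordinates from an infinite product of copies of one probability measure
  gives a finite product of copies of it, whichever coordinates are selected.\<close>

lemma exchangeable:
  assumes "inj_on p {..<n}"
  shows "distr M (\<Pi>\<^sub>M i\<in>{..<n}. borel) (\<lambda>\<omega>. \<lambda>i\<in>{..<n}. X (p i) \<omega>) =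
    (\<Pi>\<^sub>M i\<in>{..<n}. distr M borel (X 0))"
proof -
  let ?\<mu> = "distr M borel (X 0)"
  have all: "distr M (\<Pi>\<^sub>M i\<in>UNIV. borel) (\<lambda>\<omega> i. X i \<omega>) = (\<Pi>\<^sub>M i\<in>UNIV. ?\<mu>)"
  proof -
    have "(\<lambda>i. distr M borel (X i)) = (\<lambda>i. ?\<mu>)" by (rule ext) (rule ident)
    then show ?thesis
      using indep_vars_iff_distr_eq_PiM[of UNIV X "\<lambda>_. borel"] indep by (simp add: restrict_def)
  qed
  have "(\<Pi>\<^sub>M i\<in>{..<n}. ?\<mu>) =
     distr (\<Pi>\<^sub>M i\<in>UNIV. ?\<mu>) (\<Pi>\<^sub>M i\<in>{..<n}. ?\<mu>) (\<lambda>x. \<lambda>i\<in>{..<n}. x (p i))"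
    by (rule distr_PiM_reindex[symmetric]) (use assms in \<open>auto intro!: prob_space_distr\<close>)
  also have "\<dots> = distr (\<Pi>\<^sub>M i\<in>UNIV. ?\<mu>) (\<Pi>\<^sub>M i\<in>{..<n}. borel) (\<lambda>x. \<lambda>i\<in>{..<n}. x (p i))"
    by (intro distr_cong refl sets_PiM_cong) simp_all
  also have "\<dots> = distr M (\<Pi>\<^sub>M i\<in>{..<n}. borel) (\<lambda>\<omega>. \<lambda>i\<in>{..<n}. X (p i) \<omega>)"
  proof -
    have "(\<lambda>\<omega> i. X i \<omega>) \<in> measurable M (\<Pi>\<^sub>M i\<in>UNIV. borel)"
      using measurable_restrict[of UNIV X M "\<lambda>_. borel"] by (simp add: restrict_def)
    then show ?thesis
      unfolding all[symmetric] by (subst distr_distr) (simp_all add: o_def measurable_restrict)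
  qed
  finally show ?thesis by simp
qed

lemma prob_st_reindex:
  assumes "inj_on p {..<n}"
  shows "prob {\<omega> \<in> space M. st (map (\<lambda>i. X (p i) \<omega>) [0..<n]) = \<pi>} =
    prob {\<omega> \<in> space M. st (map (\<lambda>i. X i \<omega>) [0..<n]) = \<pi>}"
proof -
  let ?B = "\<Pi>\<^sub>M i\<in>{..<n}. (borel :: real measure)"
  let ?A = "(\<lambda>f. st (map f [0..<n])) -` {\<pi>} \<inter> space ?B"
  have "(\<lambda>f. st (map f [0..<n])) \<in> measurable ?B (count_space UNIV)"
    by (rule measurable_st[of n "\<lambda>i f. f i"]) simp
  then have A: "?A \<in> sets ?B" by (rule measurable_sets) simp
  have *: "prob {\<omega> \<in> space M. st (map (\<lambda>i. X (q i) \<omega>) [0..<n]) = \<pi>} =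
      measure (\<Pi>\<^sub>M i\<in>{..<n}. distr M borel (X 0)) ?A" if q: "inj_on q {..<n}" for q
  proof -
    have restr: "map (\<lambda>i\<in>{..<n}. X (q i) \<omega>) [0..<n] = map (\<lambda>i. X (q i) \<omega>) [0..<n]" for \<omega>
      by simp
    have "(\<lambda>\<omega>. \<lambda>i\<in>{..<n}. X (q i) \<omega>) \<in> measurable M ?B"
      by (rule measurable_restrict) simp
    from measure_distr[OF this A] measurable_space[OF this]
    show ?thesis
      unfolding exchangeable[OF q] restr[symmetric]
      by (auto intro!: arg_cong[where f = "measure M"])
  qed
  show ?thesis using *[OF assms] *[of "\<lambda>i. i"] by simp
qed

end

text \<open>Reading the entries of \<open>x\<close> in the order prescribed by \<open>\<pi>\<close> standardizes to \<open>\<pi>\<close> exactly when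
  \<open>x\<close> is increasing. The positions \<open>\<pi> ! i - 1\<close> are shifted because positions start at 0 and the
  values of \<open>\<pi>\<close> at 1.\<close>

lemma st_eq_iff_reindex:
  fixes x :: "nat \<Rightarrow> 'a::linorder"
  assumes \<pi>: "\<pi> \<in> permutations_of_set {1..n}"
  shows "st (map (\<lambda>i. x (\<pi> ! i - 1)) [0..<n]) = \<pi> \<longleftrightarrow> st (map x [0..<n]) = [1..<n + 1]"
proof -
  define p where "p = (\<lambda>i. \<pi> ! i - 1)"
  have len: "length \<pi> = n" using length_finite_permutations_of_set[OF \<pi>] by simp
  have img: "(!) \<pi> ` {..<n} = {1..n}"
    using nth_image[of n \<pi>] permutations_of_setD(1)[OF \<pi>] len
    unfolding lessThan_atLeast0 by simp
  have p_img: "p ` {..<n} = {..<n}"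
  proof -
    have "p ` {..<n} = (\<lambda>k. k - 1) ` {1..n}" unfolding img[symmetric] p_def by (simp add: image_image)
    also have "\<dots> = {..<n}"
    proof (intro equalityI subsetI)
      fix k assume "k \<in> {..<n}"
      then have "k = Suc k - 1" "Suc k \<in> {1..n}" by auto
      then show "k \<in> (\<lambda>k. k - 1) ` {1..n}" by (rule image_eqI)
    qed auto
    finally show ?thesis .
  qed
  have Suc_p: "Suc (p i) = \<pi> ! i" if "i < n" for i
  proof -
    have "\<pi> ! i \<in> {1..n}" unfolding img[symmetric] using that by blast
    then show ?thesis by (simp add: p_def)
  qed
  have sets: "(\<lambda>i. x (p i)) ` {0..<n} = x ` {0..<n}"
    unfolding atLeast0LessThan image_image[of x p, symmetric] p_img ..
  define r where "r = (\<lambda>i. card {y \<in> x ` {0..<n}. y \<le> x i})"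
  have "st (map (\<lambda>i. x (p i)) [0..<n]) = map (\<lambda>i. r (p i)) [0..<n]"
    by (simp add: st_def sets r_def)
  then have "st (map (\<lambda>i. x (p i)) [0..<n]) = \<pi> \<longleftrightarrow> (\<forall>i<n. r (p i) = \<pi> ! i)"
    by (simp add: list_eq_iff_nth_eq len)
  also have "\<dots> \<longleftrightarrow> (\<forall>i\<in>{..<n}. r (p i) = Suc (p i))" by (auto simp: Suc_p)
  also have "\<dots> \<longleftrightarrow> (\<forall>k\<in>p ` {..<n}. r k = Suc k)" by blast
  also have "\<dots> \<longleftrightarrow> st (map x [0..<n]) = [1..<n + 1]"
    unfolding p_img by (simp add: st_def r_def list_eq_iff_nth_eq Ball_def del: upt_Suc)
  finally show ?thesis unfolding p_def .
qed

context iid_continuous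
begin

lemma measurable_st_X [measurable]:
  "(\<lambda>\<omega>. st (map (\<lambda>i. X i \<omega>) [0..<n])) \<in> measurable M (count_space UNIV)"
  by (rule measurable_st) simp

text \<open>By exchangeability all \<open>n!\<close> permutations are as likely as the increasing one, and almost surely
  one of them is the standardization.\<close>

theorem prob_st_eq:
  assumes "\<pi> \<in> permutations_of_set {1..n}"
  shows "prob {\<omega> \<in> space M. st (map (\<lambda>i. X i \<omega>) [0..<n]) = \<pi>} = 1 / fact n"
proof -
  let ?P = "permutations_of_set {1..n}" and ?S = "\<lambda>\<omega>. st (map (\<lambda>i. X i \<omega>) [0..<n])"
  define q where "q = prob {\<omega> \<in> space M. ?S \<omega> = [1..<n + 1]}"
  have eq: "prob {\<omega> \<in> space M. ?S \<omega> = \<rho>} = q" if \<rho>: "\<rho> \<in> ?P" for \<rho>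
  proof -
    have "inj_on (\<lambda>i. \<rho> ! i - 1) {..<n}"
    proof (rule inj_onI)
      fix i j assume ij: "i \<in> {..<n}" "j \<in> {..<n}" "\<rho> ! i - 1 = \<rho> ! j - 1"
      have len: "length \<rho> = n" using length_finite_permutations_of_set[OF \<rho>] by simp
      then have "\<rho> ! i \<in> {1..n}" "\<rho> ! j \<in> {1..n}"
        using ij permutations_of_setD(1)[OF \<rho>] by (metis lessThan_iff nth_mem)+
      then have "\<rho> ! i = \<rho> ! j" using ij(3) unfolding atLeastAtMost_iff by linarith
      then show "i = j" using permutations_of_setD(2)[OF \<rho>] ij len by (simp add: nth_eq_iff_index_eq)
    qed
    from prob_st_reindex[OF this, of \<rho>]
    have "prob {\<omega> \<in> space M. ?S \<omega> = \<rho>} =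
        prob {\<omega> \<in> space M. st (map (\<lambda>i. X (\<rho> ! i - 1) \<omega>) [0..<n]) = \<rho>}" ..
    also have "\<dots> = q"
      unfolding q_def
      by (intro arg_cong[where f = prob] Collect_cong conj_cong refl st_eq_iff_reindex[OF \<rho>])
    finally show ?thesis .
  qed
  have "AE \<omega> in M. ?S \<omega> \<in> ?P"
    using AE_distinct[of n]
  proof eventually_elim
    case (elim \<omega>)
    from st_in_permutations_of_set[OF this] show ?case by simp
  qed
  then have "1 = prob {\<omega> \<in> space M. ?S \<omega> \<in> ?P}"
    by (simp add: prob_Collect_eq_1)
  also have "{\<omega> \<in> space M. ?S \<omega> \<in> ?P} = (\<Union>\<rho>\<in>?P. {\<omega> \<in> space M. ?S \<omega> = \<rho>})" by auto
  also have "prob \<dots> = (\<Sum>\<rho>\<in>?P. prob {\<omega> \<in> space M. ?S \<omega> = \<rho>})"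
    by (intro finite_measure_finite_Union) (auto simp: disjoint_family_on_def)
  also have "\<dots> = fact n * q" by (simp add: eq)
  finally show ?thesis using eq[OF assms] by (simp add: field_simps)
qed

text \<open>If \<open>\<sigma>\<close> comes first, exactly one initial segment ends with the first occurrence of \<open>\<sigma>\<close> and has
  no earlier \<open>\<tau>\<close>. For length \<open>n\<close> this event says, up to a null set, that the standardized segment
  lies in \<open>Av_ending n \<sigma> \<tau>\<close>.\<close>

theorem prob_precedes_sums:
  assumes len: "length \<tau> = length \<sigma>" and neq: "\<sigma> \<noteq> \<tau>"
  shows "(\<lambda>n. real (card (Av_ending n \<sigma> \<tau>)) / fact n) sums prob_precedes M X \<sigma> \<tau>"
proof -
  let ?S = "\<lambda>n \<omega>. st (map (\<lambda>i. X i \<omega>) [0..<n])"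
  let ?E = "\<lambda>n \<omega>. first_at_end \<sigma> \<tau> (?S n \<omega>)"
  have E_sets: "{\<omega> \<in> space M. ?E n \<omega>} \<in> events" for n by measurable
  have prec: "{\<omega> \<in> space M. first_occurrence \<sigma> (\<lambda>i. X i \<omega>) < first_occurrence \<tau> (\<lambda>i. X i \<omega>)} =
      {\<omega> \<in> space M. \<exists>n. ?E n \<omega>}"
    unfolding first_at_end_st by (intro Collect_cong conj_cong refl first_occurrence_less_iff_first_at_end[OF assms])
  have "(\<lambda>n. prob {\<omega> \<in> space M. ?E n \<omega>}) sums prob {\<omega> \<in> space M. \<exists>n. ?E n \<omega>}"
  proof (rule prob_sums)
    show "AE \<omega> in M. (\<forall>n. ?E n \<omega> \<longrightarrow> (\<exists>n. ?E n \<omega>)) \<and> ((\<exists>n. ?E n \<omega>) \<longrightarrow> (\<exists>!n. ?E n \<omega>))"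
      using first_at_end_unique[OF assms] by (auto simp: Uniq_def)
  qed measurable
  moreover have "prob {\<omega> \<in> space M. ?E n \<omega>} = real (card (Av_ending n \<sigma> \<tau>)) / fact n" for n
  proof -
    have "AE \<omega> in M. ?E n \<omega> \<longleftrightarrow> ?S n \<omega> \<in> Av_ending n \<sigma> \<tau>"
      using AE_distinct[of n]
    proof eventually_elim
      case (elim \<omega>)
      from st_in_permutations_of_set[OF this] show ?case
        by (simp add: Av_ending_conv_first_at_end)
    qed
    then have "prob {\<omega> \<in> space M. ?E n \<omega>} = prob {\<omega> \<in> space M. ?S n \<omega> \<in> Av_ending n \<sigma> \<tau>}"
      using E_sets by (intro finite_measure_eq_AE) (simp_all del: first_at_end_st)
    also have "{\<omega> \<in> space M. ?S n \<omega> \<in> Av_ending n \<sigma> \<tau>} =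
        (\<Union>\<rho>\<in>Av_ending n \<sigma> \<tau>. {\<omega> \<in> space M. ?S n \<omega> = \<rho>})" by auto
    also have "prob \<dots> = (\<Sum>\<rho>\<in>Av_ending n \<sigma> \<tau>. prob {\<omega> \<in> space M. ?S n \<omega> = \<rho>})"
      by (intro finite_measure_finite_Union)
         (auto simp: disjoint_family_on_def Av_ending_conv_first_at_end)
    also have "\<dots> = (\<Sum>\<rho>\<in>Av_ending n \<sigma> \<tau>. 1 / fact n)"
      by (intro sum.cong refl prob_st_eq) (simp add: Av_ending_conv_first_at_end)
    finally show ?thesis by simp
  qed
  ultimately show ?thesis unfolding prob_precedes_def prec by simp
qed

end

section \<open>The generating functions\<close>

text \<open>After multiplication by \<open>2 ^ (k + 2)\<close> the right side of the recurrence is at most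
  \<open>2 K + 4 K + 2 K = 8 K\<close>, while the factor \<open>N + k + 2\<close> on the left is at least 8. This both secures a radius of convergence
  above 1 and controls the tail in the numerical estimate.\<close>

lemma geometric_decay:
  fixes w e :: "nat \<Rightarrow> real"
  assumes rec: "\<And>n. real (n + 2) * w (n + 2) = w (n + 1) + w n + e (n + 1)"
    and N: "6 \<le> N" and K: "0 \<le> K" and init: "w N \<le> K" "2 * w (N + 1) \<le> K"
    and e: "\<And>k. e (N + k) * 2 ^ k \<le> K"
  shows "w (N + k) * 2 ^ k \<le> K"
proof (induction k rule: induct_nat_012)
  case (ge2 k)
  have "real (N + k + 2) * (w (N + k + 2) * 2 ^ (k + 2)) =
      2 * (w (N + k + 1) * 2 ^ (k + 1)) + 4 * (w (N + k) * 2 ^ k) + 2 * (e (N + k + 1) * 2 ^ (k + 1))"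
    using rec[of "N + k"] by (simp add: algebra_simps)
  also have "\<dots> \<le> 8 * K"
    using ge2 e[of "k + 1"] by simp
  also have "\<dots> \<le> real (N + k + 2) * K"
    using N K by (intro mult_right_mono) simp_all
  finally have "w (N + k + 2) * 2 ^ (k + 2) \<le> K"
    by (rule mult_left_le_imp_le) simp
  then show ?case by simp
qed (use init in simp_all)

definition up_coeff :: "nat \<Rightarrow> real" where "up_coeff n = real (num_up n) / fact n"

definition coeff_123 :: "nat \<Rightarrow> real" where "coeff_123 n = real (num_first_123 n) / fact n"

lemma divide_fact_step:
  "real (Suc n) * (y / fact (Suc n)) = y / fact n" for y :: real
  by (simp add: field_simps del: of_nat_Suc)

lemma up_coeff_rec: "real (n + 2) * up_coeff (n + 2) = up_coeff (n + 1) + up_coeff n"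
proof -
  have "real (n + 2) * up_coeff (n + 2) = real (num_up (n + 2)) / fact (Suc n)"
    using divide_fact_step[of "Suc n"] by (simp only: up_coeff_def add_2_eq_Suc')
  also have "\<dots> = up_coeff (n + 1) + real (Suc n) * (real (num_up n) / fact (Suc n))"
    by (simp add: up_coeff_def add_divide_distrib distrib_right del: fact_Suc)
  finally show ?thesis unfolding divide_fact_step by (simp add: up_coeff_def)
qed

lemma coeff_123_rec:
  "real (n + 2) * coeff_123 (n + 2) = coeff_123 (n + 1) + coeff_123 n + up_coeff (n + 1)"
proof -
  have "real (n + 2) * coeff_123 (n + 2) = real (num_first_123 (n + 2)) / fact (Suc n)"
    using divide_fact_step[of "Suc n"] by (simp only: coeff_123_def add_2_eq_Suc')
  also have "\<dots> = coeff_123 (n + 1) + real (Suc n) * (real (num_first_123 n) / fact (Suc n))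
      + up_coeff (n + 1)"
    by (simp add: coeff_123_def up_coeff_def add_divide_distrib distrib_right del: fact_Suc)
  finally show ?thesis unfolding divide_fact_step by (simp add: coeff_123_def)
qed

lemma coeffs_nonneg: "0 \<le> up_coeff n" "0 \<le> coeff_123 n"
  by (simp_all add: up_coeff_def coeff_123_def)

text \<open>A numeral does not match the pattern \<open>Suc (Suc n)\<close>, and unfolding the recursion to the base cases
  branches exponentially; so each value is derived from the two before it.\<close>

lemma num_up_values:
  "num_up 2 = 1" "num_up 3 = 1" "num_up 4 = 4" "num_up 5 = 8"
  "num_up 6 = 28" "num_up 7 = 76" "num_up 8 = 272" "num_up 9 = 880"
  "num_up 10 = 3328" "num_up 11 = 12128" "num_up 12 = 48736"
proof -
  show v2: "num_up 2 = 1" by (simp add: numeral_2_eq_2)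
  show v3: "num_up 3 = 1" by (simp add: numeral_3_eq_3)
  show v4: "num_up 4 = 4"
    using num_up.simps(3)[of 2] v2 v3 by (simp del: num_up.simps)
  show v5: "num_up 5 = 8"
    using num_up.simps(3)[of 3] v3 v4 by (simp del: num_up.simps)
  show v6: "num_up 6 = 28"
    using num_up.simps(3)[of 4] v4 v5 by (simp del: num_up.simps)
  show v7: "num_up 7 = 76"
    using num_up.simps(3)[of 5] v5 v6 by (simp del: num_up.simps)
  show v8: "num_up 8 = 272"
    using num_up.simps(3)[of 6] v6 v7 by (simp del: num_up.simps)
  show v9: "num_up 9 = 880"
    using num_up.simps(3)[of 7] v7 v8 by (simp del: num_up.simps)
  show v10: "num_up 10 = 3328"
    using num_up.simps(3)[of 8] v8 v9 by (simp del: num_up.simps)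
  show v11: "num_up 11 = 12128"
    using num_up.simps(3)[of 9] v9 v10 by (simp del: num_up.simps)
  show v12: "num_up 12 = 48736"
    using num_up.simps(3)[of 10] v10 v11 by (simp del: num_up.simps)
qed

lemma num_first_123_values:
  "num_first_123 2 = 0" "num_first_123 3 = 1" "num_first_123 4 = 2" "num_first_123 5 = 10"
  "num_first_123 6 = 28" "num_first_123 7 = 116" "num_first_123 8 = 388" "num_first_123 9 = 1588"
  "num_first_123 10 = 5960" "num_first_123 11 = 25168" "num_first_123 12 = 102856"
proof -
  show v2: "num_first_123 2 = 0" by (simp add: numeral_2_eq_2)
  show v3: "num_first_123 3 = 1" by (simp add: numeral_3_eq_3)
  show v4: "num_first_123 4 = 2"
    using num_first_123.simps(3)[of 2] v2 v3 by (simp del: num_first_123.simps add: num_up_values)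
  show v5: "num_first_123 5 = 10"
    using num_first_123.simps(3)[of 3] v3 v4 by (simp del: num_first_123.simps add: num_up_values)
  show v6: "num_first_123 6 = 28"
    using num_first_123.simps(3)[of 4] v4 v5 by (simp del: num_first_123.simps add: num_up_values)
  show v7: "num_first_123 7 = 116"
    using num_first_123.simps(3)[of 5] v5 v6 by (simp del: num_first_123.simps add: num_up_values)
  show v8: "num_first_123 8 = 388"
    using num_first_123.simps(3)[of 6] v6 v7 by (simp del: num_first_123.simps add: num_up_values)
  show v9: "num_first_123 9 = 1588"
    using num_first_123.simps(3)[of 7] v7 v8 by (simp del: num_first_123.simps add: num_up_values)
  show v10: "num_first_123 10 = 5960"
    using num_first_123.simps(3)[of 8] v8 v9 by (simp del: num_first_123.simps add: num_up_values)
  show v11: "num_first_123 11 = 25168"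
    using num_first_123.simps(3)[of 9] v9 v10 by (simp del: num_first_123.simps add: num_up_values)
  show v12: "num_first_123 12 = 102856"
    using num_first_123.simps(3)[of 10] v10 v11 by (simp del: num_first_123.simps add: num_up_values)
qed

lemma sum_11: "(\<Sum>n<11. coeff_123 n) = 355 / 864"
  by (simp add: coeff_123_def num_first_123_values fact_numeral lessThan_nat_numeral)

text \<open>Index 11 is late enough for the tail bound \<open>2 * coeff_123 11\<close>, about 0.0013, to separate the
  partial sum 0.4109 from 0.4125, while adding the single term \<open>coeff_123 11\<close> lifts it above 0.4115.\<close>

lemma coeffs_decay:
  shows "up_coeff (11 + k) * 2 ^ k \<le> coeff_123 11" "coeff_123 (11 + k) * 2 ^ k \<le> coeff_123 11"
proof -
  have v: "up_coeff 11 = 12128 / fact 11" "up_coeff 12 = 48736 / fact 12"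
      "coeff_123 11 = 25168 / fact 11" "coeff_123 12 = 102856 / fact 12"
    by (simp_all add: up_coeff_def coeff_123_def num_up_values num_first_123_values)
  have up: "up_coeff (11 + k) * 2 ^ k \<le> coeff_123 11" for k
  proof (rule geometric_decay[where e = "\<lambda>_. 0"])
    show "real (n + 2) * up_coeff (n + 2) = up_coeff (n + 1) + up_coeff n + 0" for n
      using up_coeff_rec[of n] by simp
  qed (simp_all add: coeffs_nonneg v fact_numeral)
  show "up_coeff (11 + k) * 2 ^ k \<le> coeff_123 11" by (rule up)
  show "coeff_123 (11 + k) * 2 ^ k \<le> coeff_123 11"
    by (rule geometric_decay[where e = up_coeff, OF coeff_123_rec _ _ _ _ up])
       (simp_all add: v fact_numeral)
qed

definition up_fps :: "real fps" where "up_fps = Abs_fps up_coeff"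

definition fps_123 :: "real fps" where "fps_123 = Abs_fps coeff_123"

lemma fps_conv_radius_ge:
  fixes w :: "nat \<Rightarrow> real"
  assumes nonneg: "\<And>n. 0 \<le> w n" and decay: "\<And>k. w (N + k) * 2 ^ k \<le> K"
  shows "3 / 2 \<le> fps_conv_radius (Abs_fps w)"
proof -
  have "summable (\<lambda>k. w (k + N) * (3 / 2) ^ (k + N))"
  proof (rule summable_comparison_test')
    show "summable (\<lambda>k. K * (3 / 2) ^ N * (3 / 4 :: real) ^ k)"
      by (intro summable_mult summable_geometric) simp
    fix k
    have "(3 / 2 :: real) ^ k = 2 ^ k * (3 / 4) ^ k" by (simp flip: power_mult_distrib)
    then have "norm (w (k + N) * (3 / 2) ^ (k + N)) = w (N + k) * 2 ^ k * ((3 / 2) ^ N * (3 / 4) ^ k)"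
      using nonneg[of "N + k"] by (simp only: power_add real_norm_def abs_mult add.commute[of k]) simp
    also have "\<dots> \<le> K * ((3 / 2) ^ N * (3 / 4) ^ k)"
      using decay[of k] by (intro mult_right_mono) simp_all
    finally show "norm (w (k + N) * (3 / 2) ^ (k + N)) \<le> K * (3 / 2) ^ N * (3 / 4) ^ k"
      by (simp add: mult.assoc)
  qed
  then have "summable (\<lambda>n. w n * (3 / 2) ^ n)"
    by (rule summable_iff_shift[THEN iffD1])
  from conv_radius_geI[OF this] show ?thesis
    by (simp add: fps_conv_radius_def)
qed

lemma conv_radius_gt:
  assumes "\<bar>x\<bar> \<le> (1 :: real)"
  shows "ereal \<bar>x\<bar> < fps_conv_radius up_fps" "ereal \<bar>x\<bar> < fps_conv_radius fps_123"
proof -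
  have "ereal \<bar>x\<bar> < 3 / 2" using assms by (simp add: ereal_divide)
  then show "ereal \<bar>x\<bar> < fps_conv_radius up_fps"
    unfolding up_fps_def
    using fps_conv_radius_ge[OF coeffs_nonneg(1) coeffs_decay(1)] by (rule less_le_trans)
  from \<open>ereal \<bar>x\<bar> < 3 / 2\<close> show "ereal \<bar>x\<bar> < fps_conv_radius fps_123"
    unfolding fps_123_def
    using fps_conv_radius_ge[OF coeffs_nonneg(2) coeffs_decay(2)] by (rule less_le_trans)
qed

text \<open>The recurrences as differential equations \<open>C' = (1 + x) C - 1\<close> and
  \<open>A' = (1 + x) A + C - 1\<close>. The constants account for the index 1, where both coefficients
  are 0 although the recurrence would add \<open>up_coeff 0 = 1\<close>.\<close>

lemma fps_deriv_up: "fps_deriv up_fps = up_fps + fps_X * up_fps - 1"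
proof (rule fps_ext)
  fix n
  show "fps_nth (fps_deriv up_fps) n = fps_nth (up_fps + fps_X * up_fps - 1) n"
  proof (cases n)
    case (Suc m)
    then show ?thesis
      using up_coeff_rec[of m] by (simp add: up_fps_def del: of_nat_Suc of_nat_add)
  qed (simp add: up_fps_def up_coeff_def)
qed

lemma fps_deriv_123: "fps_deriv fps_123 = fps_123 + fps_X * fps_123 + up_fps - 1"
proof (rule fps_ext)
  fix n
  show "fps_nth (fps_deriv fps_123) n = fps_nth (fps_123 + fps_X * fps_123 + up_fps - 1) n"
  proof (cases n)
    case (Suc m)
    then show ?thesis
      using coeff_123_rec[of m] by (simp add: up_fps_def fps_123_def del: of_nat_Suc of_nat_add)
  qed (simp add: up_fps_def fps_123_def up_coeff_def coeff_123_def)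
qed

lemma has_field_derivative_up:
  assumes "\<bar>x\<bar> \<le> (1 :: real)"
  shows "(eval_fps up_fps has_field_derivative (1 + x) * eval_fps up_fps x - 1) (at x within A)"
    and "(eval_fps fps_123 has_field_derivative
            (1 + x) * eval_fps fps_123 x + eval_fps up_fps x - 1) (at x within A)"
proof -
  note r = conv_radius_gt[OF assms]
  have X: "ereal \<bar>x\<bar> < fps_conv_radius (fps_X * F)" if "ereal \<bar>x\<bar> < fps_conv_radius F" for F
    using that by (intro less_le_trans[OF _ fps_conv_radius_mult]) simp
  have add: "ereal \<bar>x\<bar> < fps_conv_radius (F + G)"
    if "ereal \<bar>x\<bar> < fps_conv_radius F" "ereal \<bar>x\<bar> < fps_conv_radius G" for F G
    using that by (intro less_le_trans[OF _ fps_conv_radius_add]) simp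
  show "(eval_fps up_fps has_field_derivative (1 + x) * eval_fps up_fps x - 1) (at x within A)"
    using has_field_derivative_eval_fps[of x up_fps A] r
    by (simp add: fps_deriv_up eval_fps_diff eval_fps_add eval_fps_mult X add algebra_simps)
  show "(eval_fps fps_123 has_field_derivative
            (1 + x) * eval_fps fps_123 x + eval_fps up_fps x - 1) (at x within A)"
    using has_field_derivative_eval_fps[of x fps_123 A] r
    by (simp add: fps_deriv_123 eval_fps_diff eval_fps_add eval_fps_mult X add algebra_simps)
qed

text \<open>With the integrating factor \<open>exp (- x - x\<^sup>2 / 2)\<close>, the equation for \<open>C\<close> integrates at once. For \<open>A\<close>
  one further integration is needed; integrating \<open>J\<close> by parts suggests the combination shown to be
  constant below.\<close>

lemma eval_closed_form:
  fixes J :: "real \<Rightarrow> real"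
  defines "J \<equiv> \<lambda>x. integral {0..x} (\<lambda>t. exp (- t - t\<^sup>2 / 2))"
  assumes x: "x \<in> {0..1}"
  shows "eval_fps up_fps x = exp (x + x\<^sup>2 / 2) * (1 - J x)"
    and "eval_fps fps_123 x = exp (x + x\<^sup>2 / 2) * (x + 1 - (x + 2) * J x) - 1"
proof -
  let ?E = "\<lambda>x :: real. exp (- x - x\<^sup>2 / 2)"
  let ?f = "eval_fps up_fps" and ?g = "eval_fps fps_123"
  have J: "(J has_field_derivative ?E x) (at x within {0..1})" if "x \<in> {0..1}" for x
    unfolding J_def using that by (intro integral_has_real_derivative continuous_intros) auto
  have [simp]: "J 0 = 0" by (simp add: J_def)
  have inv: "exp (y + y\<^sup>2 / 2) * ?E y = 1" for y :: real
    by (simp flip: exp_add)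
  have start: "?f 0 = 1" "?g 0 = 0"
    by (simp_all add: eval_fps_at_0 up_fps_def fps_123_def up_coeff_def coeff_123_def)
  have "\<exists>c. \<forall>x\<in>{0..1}. ?f x * ?E x + J x = c"
  proof (rule has_field_derivative_zero_constant)
    fix x :: real assume x: "x \<in> {0..1}"
    show "((\<lambda>x. ?f x * ?E x + J x) has_field_derivative 0) (at x within {0..1})"
      using x by (auto intro!: derivative_eq_intros has_field_derivative_up J simp: algebra_simps)
  qed simp
  then obtain c where c: "?f x * ?E x + J x = c" if "x \<in> {0..1}" for x by blast
  from c[of 0] have "c = 1" using start by simp
  with c have fE: "?f x * ?E x = 1 - J x" if "x \<in> {0..1}" for x using that by fastforce
  have "?f x = exp (x + x\<^sup>2 / 2) * (?f x * ?E x)" using inv[of x] by algebra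
  then show "?f x = exp (x + x\<^sup>2 / 2) * (1 - J x)" unfolding fE[OF x] .
  \<comment> \<open>the derivative below vanishes because \<open>?f x * ?E x = 1 - J x\<close>\<close>
  have "\<exists>c. \<forall>x\<in>{0..1}. (?g x + 1) * ?E x + (x + 2) * J x - x = c"
  proof (rule has_field_derivative_zero_constant)
    fix x :: real assume x: "x \<in> {0..1}"
    have "((\<lambda>x. (?g x + 1) * ?E x + (x + 2) * J x - x) has_field_derivative
        (((1 + x) * ?g x + ?f x - 1) * ?E x + (?g x + 1) * (?E x * (- 1 - x)) +
         (J x + (x + 2) * ?E x) - 1)) (at x within {0..1})"
      using x by (auto intro!: derivative_eq_intros has_field_derivative_up J simp: algebra_simps)
    moreover have "((1 + x) * ?g x + ?f x - 1) * ?E x + (?g x + 1) * (?E x * (- 1 - x)) +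
         (J x + (x + 2) * ?E x) - 1 = 0"
      using fE[OF x] by algebra
    ultimately show "((\<lambda>x. (?g x + 1) * ?E x + (x + 2) * J x - x) has_field_derivative 0) (at x within {0..1})"
      by simp
  qed simp
  then obtain d where d: "(?g x + 1) * ?E x + (x + 2) * J x - x = d" if "x \<in> {0..1}" for x by blast
  from d[of 0] have "d = 1" using start by simp
  with d[OF x] have "(?g x + 1) * ?E x = x + 1 - (x + 2) * J x" by simp
  moreover have "?g x + 1 = exp (x + x\<^sup>2 / 2) * ((?g x + 1) * ?E x)" using inv[of x] by algebra
  ultimately show "?g x = exp (x + x\<^sup>2 / 2) * (x + 1 - (x + 2) * J x) - 1" by simp
qed

text \<open>The defining series converges fast enough to be bounded between its 12-term partial sum and
  its 11-term partial sum increased by a geometric tail.\<close>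

lemma eval_numeric: "\<bar>eval_fps fps_123 1 - 0.412\<bar> < 0.0005"
proof -
  have "summable (\<lambda>n. coeff_123 n)"
    using summable_fps[of 1 fps_123] conv_radius_gt(2)[of 1] by (simp add: fps_123_def)
  then have split: "eval_fps fps_123 1 = (\<Sum>k. coeff_123 (k + 11)) + (\<Sum>n<11. coeff_123 n)"
    and sm: "summable (\<lambda>k. coeff_123 (k + 11))"
    by (simp_all add: eval_fps_def fps_123_def suminf_split_initial_segment summable_iff_shift)
  have "coeff_123 11 = (\<Sum>k<1. coeff_123 (k + 11))" by simp
  also have "\<dots> \<le> (\<Sum>k. coeff_123 (k + 11))"
    using sm by (intro sum_le_suminf) (simp_all add: coeffs_nonneg)
  finally have lower: "coeff_123 11 \<le> (\<Sum>k. coeff_123 (k + 11))" .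
  have "(\<Sum>k. coeff_123 (k + 11)) \<le> (\<Sum>k. coeff_123 11 * (1 / 2) ^ k)"
  proof (intro suminf_le sm summable_mult summable_geometric)
    fix k show "coeff_123 (k + 11) \<le> coeff_123 11 * (1 / 2) ^ k"
      using coeffs_decay(2)[of k] by (simp add: power_divide field_simps add.commute)
  qed simp
  also have "\<dots> = 2 * coeff_123 11"
    by (simp add: suminf_mult suminf_geometric summable_geometric)
  finally have upper: "(\<Sum>k. coeff_123 (k + 11)) \<le> 2 * coeff_123 11" .
  have "coeff_123 11 = 25168 / 39916800" by (simp add: coeff_123_def num_first_123_values fact_numeral)
  moreover have "\<bar>t + 355 / 864 - 0.412\<bar> < 0.0005"
    if "25168 / 39916800 \<le> t" "t \<le> 2 * (25168 / 39916800)" for t :: real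
    using that unfolding abs_less_iff by (intro conjI) simp_all
  ultimately show ?thesis using lower upper unfolding split sum_11 by simp
qed

section \<open>The probability that 123 precedes 213\<close>

theorem corollary4p5:
  fixes M :: "'w measure" and X :: "nat \<Rightarrow> 'w \<Rightarrow> real"
    and a :: "nat \<Rightarrow> nat"
  assumes "prob_space M"
    and indep: "prob_space.indep_vars M (\<lambda>_. borel) X UNIV"
    and ident: "\<And>i j. distr M borel (X i) = distr M borel (X j)"
    and cont: "\<And>i. continuous_on UNIV (cdf (distr M borel (X i)))"
    and a_def: "\<And>n. a n = card (Av_ending n [1, 2, 3] [2, 1, 3])"
  shows "prob_precedes M X [1, 2, 3] [2, 1, 3]
           = exp (3 / 2) * (2 - 3 * integral {0..1} (\<lambda>t. exp (- t - t\<^sup>2 / 2))) - 1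
       \<and> \<bar>prob_precedes M X [1, 2, 3] [2, 1, 3] - 0.412\<bar> < 0.0005
       \<and> summable (\<lambda>n. real (a n) * (1 ^ n / fact n))
       \<and> prob_precedes M X [1, 2, 3] [2, 1, 3] = egf a 1"
proof -
  interpret iid_continuous M X
    using assms(1-4) by (simp add: iid_continuous_def iid_continuous_axioms_def)
  let ?P = "prob_precedes M X [1, 2, 3] [2, 1, 3]"
  have a: "a n = num_first_123 n" for n
    using card_first_123_at_end[of "{1..n}"] unfolding a_def Av_ending_123_213 by simp
  have summand: "real (a n) * (1 ^ n / fact n) = coeff_123 n" for n
    by (simp add: a coeff_123_def)
  have "(\<lambda>n. real (a n) / fact n) sums ?P"
    using prob_precedes_sums[of "[2, 1, 3]" "[1, 2, 3]"] by (simp add: a_def)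
  then have sums: "coeff_123 sums ?P"
    by (simp add: a coeff_123_def[abs_def])
  then have "?P = eval_fps fps_123 1"
    by (simp add: eval_fps_def fps_123_def sums_iff)
  moreover have "eval_fps fps_123 1
      = exp (3 / 2) * (2 - 3 * integral {0..1} (\<lambda>t. exp (- t - t\<^sup>2 / 2))) - 1"
    using eval_closed_form(2)[of 1] by simp
  moreover have "?P = egf a 1"
    unfolding egf_def summand using sums by (simp add: sums_iff)
  moreover have "summable (\<lambda>n. real (a n) * (1 ^ n / fact n))"
    unfolding summand using sums by (simp add: sums_iff)
  ultimately show ?thesis using eval_numeric by metis
qed

end
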